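(* Let $(X,d)$ be a metric space and $\delta$ a semimetric on $X$. Suppose there exists $K\ge1$ such that for all $x,y\in X$ with $x\ne y$, $$\frac1K\le\frac{\delta(x,y)}{d(x,y)}\le K.$$ Let $T\colon X\to X$ satisfy the additive contraction condition $$d(Tx,Ty)+\delta(Tx,Ty)\le\beta\,\big(d(x,y)+\delta(x,y)\big)\quad\text{for all }x,y\in X,$$ with $\beta\in[0,1)$. If $\beta<\frac{2\sqrt K}{1+K}$, then $T$ is a multiplicative contraction: $$d(Tx,Ty)\,\delta(Tx,Ty)\le\beta'\,d(x,y)\,\delta(x,y)\quad\text{for all }x,y\in X,$$ with $\beta'=\frac{\beta^2(K+1)^2}{4K}<1$.
   Context: A semimetric on a nonempty set $X$ is a map $\delta\colon X\times X\to[0,\infty)$ such that $\delta(x,y)=0$ if and only if $x=y$, and $\delta(x,y)=\delta(y,x)$ for all $x,y\in X$ (no triangle inequality is required). *)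

theory Defs
  imports "HOL-Analysis.Abstract_Metric_Spaces"
begin

text \<open>As for \<^locale>\<open>Metric_space\<close>, the space is an explicit carrier set; values of \<open>\<delta>\<close> outside
  the carrier are unconstrained.\<close>

definition semimetric_on :: "'a set \<Rightarrow> ('a \<Rightarrow> 'a \<Rightarrow> real) \<Rightarrow> bool" where
  "semimetric_on X \<delta> \<longleftrightarrow>
     X \<noteq> {} \<and>
     (\<forall>x\<in>X. \<forall>y\<in>X. 0 \<le> \<delta> x y) \<and>
     (\<forall>x\<in>X. \<forall>y\<in>X. \<delta> x y = 0 \<longleftrightarrow> x = y) \<and>
     (\<forall>x\<in>X. \<forall>y\<in>X. \<delta> x y = \<delta> y x)"

end

theory Submission
  imports Defs
begin

text \<open>Apply AM-GM to \<open>d (T x) (T y)\<close> and \<open>\<delta> (T x) (T y)\<close>, then a converse AM-GM inequality to \<open>d x y\<close>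
  and \<open>\<delta> x y\<close>: numbers whose ratio lies in \<open>[1/K, K]\<close> satisfy \<open>K (a + b)\<^sup>2 \<le> (K + 1)\<^sup>2 a b\<close>,
  because \<open>(K a - b) (K b - a) \<ge> 0\<close>.\<close>

lemma reverse_AM_GM:
  fixes a b K :: real
  assumes "b \<le> K * a" and "a \<le> K * b"
  shows "K * (a + b)\<^sup>2 \<le> (K + 1)\<^sup>2 * (a * b)"
proof -
  have "0 \<le> (K * a - b) * (K * b - a)"
    using assms by simp
  \<comment> \<open>Expanding gives
    \<open>K * (a\<^sup>2 + b\<^sup>2) \<le> (K\<^sup>2 + 1) * (a * b)\<close>; adding
    \<open>2 * K * (a * b)\<close> to both sides completes the squares.\<close>
  then show ?thesis
    by (simp add: power2_eq_square algebra_simps)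
qed

theorem theorem5p3:
  fixes X :: "'a set" and d \<delta> :: "'a \<Rightarrow> 'a \<Rightarrow> real" and T :: "'a \<Rightarrow> 'a" and K \<beta> :: real
  assumes "Metric_space X d"
    and "semimetric_on X \<delta>"
    and "K \<ge> 1"
    and "\<And>x y. x \<in> X \<Longrightarrow> y \<in> X \<Longrightarrow> x \<noteq> y \<Longrightarrow> 1 / K \<le> \<delta> x y / d x y \<and> \<delta> x y / d x y \<le> K"
    and "T \<in> X \<rightarrow> X"
    and "0 \<le> \<beta>" and "\<beta> < 1"
    and "\<And>x y. x \<in> X \<Longrightarrow> y \<in> X \<Longrightarrow>
           d (T x) (T y) + \<delta> (T x) (T y) \<le> \<beta> * (d x y + \<delta> x y)"
    and "\<beta> < 2 * sqrt K / (1 + K)"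
  shows "(\<forall>x\<in>X. \<forall>y\<in>X.
            d (T x) (T y) * \<delta> (T x) (T y) \<le> \<beta>\<^sup>2 * (K + 1)\<^sup>2 / (4 * K) * (d x y * \<delta> x y))
         \<and> \<beta>\<^sup>2 * (K + 1)\<^sup>2 / (4 * K) < 1"
proof (intro conjI ballI)
  interpret Metric_space X d by fact
  note K = \<open>K \<ge> 1\<close>
  fix x y assume xy: "x \<in> X" "y \<in> X"
  then have Txy: "T x \<in> X" "T y \<in> X"
    using \<open>T \<in> X \<rightarrow> X\<close> by auto
  define a b p q where "a = d x y" and "b = \<delta> x y" and "p = d (T x) (T y)" and "q = \<delta> (T x) (T y)"
  note defs = this
  have nonneg: "0 \<le> p" "0 \<le> q"
    using Txy assms(2) by (auto simp: defs semimetric_on_def)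
  \<comment> \<open>Clearing denominators makes the ratio bounds meaningful also for
    \<open>x = y\<close>, where both distances vanish.\<close>
  have ratio: "b \<le> K * a \<and> a \<le> K * b"
  proof (cases "x = y")
    case True
    then have "a = 0" "b = 0"
      using xy assms(2) by (auto simp: defs semimetric_on_def)
    then show ?thesis
      by simp
  next
    case False
    then have "0 < a"
      using xy by (simp add: a_def)
    moreover have "1 / K \<le> b / a" "b / a \<le> K"
      using assms(4)[OF xy False] by (simp_all add: defs)
    ultimately show ?thesis
      using K by (simp add: field_simps)
  qed
  \<comment> \<open>AM-GM, from \<open>(p - q)\<^sup>2 \<ge> 0\<close>.\<close>
  have "4 * (p * q) \<le> (p + q)\<^sup>2"
    using zero_le_power2[of "p - q"] by (simp add: power2_eq_square algebra_simps)
  also have "\<dots> \<le> (\<beta> * (a + b))\<^sup>2"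
    using assms(8)[OF xy] nonneg by (intro power_mono) (simp_all add: defs)
  \<comment> \<open>The factor \<open>K\<close> produces the left side of
    \<open>reverse_AM_GM\<close>, and dividing by \<open>4 * K\<close> at the end yields the
    constant \<beta>'.\<close>
  finally have "4 * K * (p * q) \<le> K * (\<beta> * (a + b))\<^sup>2"
    using K by simp
  also have "\<dots> = \<beta>\<^sup>2 * (K * (a + b)\<^sup>2)"
    by (simp add: power_mult_distrib)
  also have "\<dots> \<le> \<beta>\<^sup>2 * ((K + 1)\<^sup>2 * (a * b))"
    using ratio by (intro mult_left_mono reverse_AM_GM) simp_all
  finally have "p * q \<le> \<beta>\<^sup>2 * (K + 1)\<^sup>2 / (4 * K) * (a * b)"
    using K by (simp add: field_simps)
  then show "d (T x) (T y) * \<delta> (T x) (T y) \<le> \<beta>\<^sup>2 * (K + 1)\<^sup>2 / (4 * K) * (d x y * \<delta> x y)"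
    by (simp add: defs)
next
  \<comment> \<open>The bound on \<beta> says exactly that the square root of \<beta>' is below 1;
    squaring keeps the strict inequality because the left side is nonnegative.\<close>
  have "\<beta> * (K + 1) < 2 * sqrt K"
    using assms(3,9) by (simp add: field_simps)
  then have "(\<beta> * (K + 1))\<^sup>2 < (2 * sqrt K)\<^sup>2"
    using assms(3,6) by (intro power_strict_mono) simp_all
  then show "\<beta>\<^sup>2 * (K + 1)\<^sup>2 / (4 * K) < 1"
    using assms(3) by (simp add: power_mult_distrib)
qed

end
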